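(* Let $\min(n,m)\ge 2$, $c\in\mathbb{R}^m$, $d\in\mathbb{R}^n$, $R\in\mathbb{R}^{n\times m}$, and let $\mathcal{E}_x=\{x_c+Fu : u\in\mathbb{R}^m,\|u\|\le 1\}$ and $\mathcal{E}_y=\{y_c+Gw : w\in\mathbb{R}^n,\|w\|\le 1\}$ be full-dimensional ellipsoids, with $F\in\mathbb{R}^{m\times m}$, $G\in\mathbb{R}^{n\times n}$ nonsingular. Let $z^*=\min\{f(x,y) : x\in\mathcal{E}_x,\ y\in\mathcal{E}_y\}$, where $f(x,y)=c^Tx+d^Ty+y^TRx$. Put $\gamma=c^Tx_c+d^Ty_c+y_c^TRx_c$, $c'=F^T(c+R^Ty_c)$, $d'=G^T(d+Rx_c)$, $R'=G^TRF$, and for $\alpha\in\mathbb{R}$ let $$M(\alpha)=\begin{pmatrix}M_0(\alpha)^T\\ \bar M(\alpha)\end{pmatrix}=\begin{pmatrix}-\alpha&c'^T\\ d'&R'\end{pmatrix}\in\mathbb{R}^{(n+1)\times(m+1)}.$$ Then the following statements, which establish the correctness of the bisection algorithm described in the context, hold. (i) The largest $\alpha$ with $M(\alpha)\in\mathrm{LOP}(n+1,m+1)$ lies in the interval $[\,-\|c'\|-\|d'\|-\|R'\|_2,\ -\max(\|c'\|,\|d'\|)\,]$, and $M(\alpha)\in\mathrm{LOP}(n+1,m+1)$ for every $\alpha\le-\|c'\|-\|d'\|-\|R'\|_2$. (ii) For every $\alpha\le-\max(\|c'\|,\|d'\|)$, $M(\alpha)\in\mathrm{LOP}(n+1,m+1)$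 if and only if the trust-region subproblem $\min\{(M_0(\alpha)^T(1;u))^2-\|\bar M(\alpha)(1;u)\|^2 : u\in\mathbb{R}^m,\ \|u\|\le 1\}$ has nonnegative optimal value. (iii) Let $\epsilon>0$, and let $\alpha_{\min}\le\alpha_{\max}\le-\max(\|c'\|,\|d'\|)$ satisfy $M(\alpha_{\min})\in\mathrm{LOP}(n+1,m+1)$ and $\alpha_{\max}-\alpha_{\min}\le\epsilon$. Then $\gamma+\alpha_{\min}\le z^*$. If moreover $\alpha\in[\alpha_{\min},\alpha_{\max}]$ has $M(\alpha)\notin\mathrm{LOP}(n+1,m+1)$, then there is $u\in\mathbb{R}^m$ with $\|u\|\le 1$ and $M_0(\alpha)^T(1;u)<\|\bar M(\alpha)(1;u)\|$; and for any such $u$, setting $\bar v=\bar M(\alpha)(1;u)$ and $w=-\bar v/\|\bar v\|$, the point $(x,y)=(x_c+Fu,\ y_c+Gw)$ is feasible ($x\in\mathcal{E}_x$, $y\in\mathcal{E}_y$) and $f(x,y)<\gamma+\alpha_{\min}+\epsilon\le z^*+\epsilon$.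
   Context: All matrices are real; $\|\cdot\|$ is the Euclidean norm on vectors and $\|R\|_2$ the spectral norm; $(a;b)$ denotes vertical concatenation. The Lorentz cone in $\mathbb{R}^r$ ($r\ge 3$) is $L_r=\{(y_0,\ldots,y_{r-1})^T : \sum_{i=1}^{r-1}y_i^2\le y_0^2,\ y_0\ge 0\}$. The Lorentz positive cone is $\mathrm{LOP}(n+1,m+1)=\{M\in\mathbb{R}^{(n+1)\times(m+1)} : Mx\in L_{n+1}\ \forall x\in L_{m+1}\}$. Bisection algorithm for the bilinear problem: initialize $\alpha_{\min}=-\|c'\|-\|d'\|-\|R'\|_2$ and $\alpha_{\max}=-\max(\|c'\|,\|d'\|)$. While $\alpha_{\max}-\alpha_{\min}>\epsilon$, set $\alpha=(\alpha_{\min}+\alpha_{\max})/2$ and decide, by solving a single trust-region subproblem in $\mathbb{R}^m$, whether $M(\alpha)\in\mathrm{LOP}(n+1,m+1)$; if so replace $\alpha_{\min}$ by $\alpha$, and otherwise replace $\alpha_{\max}$ by $\alpha$. *)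

theory Defs
  imports "HOL-Analysis.Analysis"
begin

text \<open>
  The index set of the space of dimension \<open>k + 1\<close> is the type \<open>'k option\<close>, where \<open>CARD('k)\<close> is
  \<open>k\<close>: the coordinate with index 0 is \<open>None\<close> and the remaining coordinates are \<open>Some i\<close>.
\<close>

definition vcat :: "real \<Rightarrow> real ^ 'k::finite \<Rightarrow> real ^ ('k option)" where
  "vcat a b = (\<chi> i. case i of None \<Rightarrow> a | Some j \<Rightarrow> b $ j)"

definition lorentz_cone :: "(real ^ ('k::finite option)) set" where
  "lorentz_cone = {y. (\<Sum>i\<in>UNIV. (y $ Some i)\<^sup>2) \<le> (y $ None)\<^sup>2 \<and> 0 \<le> y $ None}"

definition LOP :: "(real ^ ('m::finite option) ^ ('n::finite option)) set" where
  "LOP = {M. \<forall>x\<in>lorentz_cone. M *v x \<in> lorentz_cone}"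

text \<open>The block matrix with rows \<open>(a, b\<^sup>T)\<close> and \<open>(e, A)\<close>.\<close>

definition block_matrix ::
    "real \<Rightarrow> real ^ 'm::finite \<Rightarrow> real ^ 'n::finite \<Rightarrow> real ^ 'm ^ 'n \<Rightarrow> real ^ ('m option) ^ ('n option)" where
  "block_matrix a b e A =
     (\<chi> i. case i of None \<Rightarrow> vcat a b | Some j \<Rightarrow> vcat (e $ j) (A $ j))"

definition top_row :: "real ^ 'k ^ ('n::finite option) \<Rightarrow> real ^ 'k" where
  "top_row M = M $ None"

definition lower_rows :: "real ^ 'k ^ ('n::finite option) \<Rightarrow> real ^ 'k ^ 'n" where
  "lower_rows M = (\<chi> i. M $ Some i)"

definition spectral_norm :: "real ^ 'm::finite ^ 'n::finite \<Rightarrow> real" where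
  "spectral_norm A = onorm (\<lambda>x. A *v x)"

definition ellipsoid :: "real ^ 'k::finite \<Rightarrow> real ^ 'k ^ 'k \<Rightarrow> (real ^ 'k) set" where
  "ellipsoid p F = {p + F *v u | u. norm u \<le> 1}"

definition bilinear_obj ::
    "real ^ 'm::finite \<Rightarrow> real ^ 'n::finite \<Rightarrow> real ^ 'm ^ 'n \<Rightarrow> real ^ 'm \<Rightarrow> real ^ 'n \<Rightarrow> real" where
  "bilinear_obj c d R x y = c \<bullet> x + d \<bullet> y + y \<bullet> (R *v x)"

text \<open>\<open>is_min_value g S v\<close>: the minimum of \<open>g\<close> over \<open>S\<close> is attained and equals \<open>v\<close>.\<close>

definition is_min_value :: "('a \<Rightarrow> real) \<Rightarrow> 'a set \<Rightarrow> real \<Rightarrow> bool" where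
  "is_min_value g S v \<longleftrightarrow> (\<exists>s\<in>S. g s = v) \<and> (\<forall>s\<in>S. v \<le> g s)"

end

theory Submission
  imports Defs
begin

text \<open>
  Substituting \<open>x = xc + F u\<close> and \<open>y = yc + G w\<close> turns the problem over the two ellipsoids into
  the minimization of \<open>q(u, w) = c' \<bullet> u + d' \<bullet> w + w \<bullet> R' u\<close> over two unit balls, up to the
  additive constant \<open>\<gamma>\<close>. For fixed \<open>u\<close> the best \<open>w\<close> points against \<open>d' + R' u\<close>, so the inner
  minimum is \<open>c' \<bullet> u - norm (d' + R' u)\<close>. Hence \<open>\<alpha>\<close> is a lower bound of \<open>q\<close> exactly when
  \<open>norm (d' + R' u) \<le> - \<alpha> + c' \<bullet> u\<close> on the unit ball. By homogeneity it suffices to test the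
  Lorentz cone on its slice \<open>(1; u)\<close>, so this says exactly that \<open>M(\<alpha>)\<close> maps the one Lorentz
  cone into the other (\<open>block_matrix_LOP_iff\<close>, \<open>block_matrix_LOP_iff_lower_bound\<close>). The largest
  \<open>\<alpha>\<close> with \<open>M(\<alpha>)\<close> in the Lorentz positive cone is therefore \<open>zstar - \<gamma>\<close>.

  The interval in (i) consists of the obvious bounds on the minimum of \<open>q\<close>: the lower end is the
  triangle inequality, and the upper end comes from setting one of the variables to zero. For
  (ii), once \<open>\<alpha> \<le> - norm c'\<close> the right hand side \<open>- \<alpha> + c' \<bullet> u\<close> is nonnegative on the whole
  ball, so the inequality may be squared. For (iii), a violating \<open>u\<close> together with its best \<open>w\<close>
  attains \<open>q(u, w) < \<alpha> \<le> \<alpha>min + \<epsilon>\<close>, while \<open>\<alpha>min\<close> is a lower bound of \<open>q\<close>.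
\<close>

section \<open>Block vectors, block matrices and the Lorentz cone\<close>

lemma vcat_nth [simp]: "vcat a b $ None = a" "vcat a b $ Some j = b $ j"
  by (simp_all add: vcat_def)

lemma vcat_cases:
  fixes x :: "real ^ ('k::finite option)"
  obtains a b where "x = vcat a b"
proof
  show "x = vcat (x $ None) (\<chi> j. x $ Some j)"
    by (simp add: vec_eq_iff vcat_def split: option.split)
qed

lemma sum_option: "(\<Sum>i\<in>UNIV. g i) = g None + (\<Sum>j\<in>UNIV. g (Some j))"
  for g :: "'k::finite option \<Rightarrow> real"
  by (simp add: UNIV_option_conv sum.reindex)

lemma inner_vcat: "vcat a b \<bullet> vcat a' b' = a * a' + b \<bullet> b'"
  by (simp add: inner_vec_def sum_option)

lemma vcat_mem_lorentz_cone: "vcat a b \<in> lorentz_cone \<longleftrightarrow> norm b \<le> a"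
proof -
  have "(\<Sum>i\<in>UNIV. (b $ i)\<^sup>2) = (norm b)\<^sup>2"
    by (simp add: norm_vec_def L2_set_def sum_nonneg)
  then have "vcat a b \<in> lorentz_cone \<longleftrightarrow> (norm b)\<^sup>2 \<le> a\<^sup>2 \<and> 0 \<le> a"
    by (simp add: lorentz_cone_def)
  also have "\<dots> \<longleftrightarrow> norm b \<le> a"
    by (meson norm_ge_zero order_trans power2_le_imp_le power_mono)
  finally show ?thesis .
qed

lemma top_row_block_matrix: "top_row (block_matrix a b e A) = vcat a b"
  by (simp add: top_row_def block_matrix_def)

lemma lower_rows_block_matrix_mult:
  "lower_rows (block_matrix a b e A) *v vcat s x = s *\<^sub>R e + A *v x"
  by (simp add: vec_eq_iff matrix_vector_mult_def lower_rows_def block_matrix_def sum_option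
      mult.commute)

lemma block_matrix_mult:
  "block_matrix a b e A *v vcat s x = vcat (a * s + b \<bullet> x) (s *\<^sub>R e + A *v x)"
  by (simp add: vec_eq_iff matrix_vector_mult_def block_matrix_def sum_option inner_vec_def
      vcat_def mult.commute split: option.split)

text \<open>
  A nonzero point of the cone is a positive multiple of some \<open>(1; u)\<close> with \<open>u\<close> in the unit ball,
  and the inclusion is homogeneous; the only point with vanishing leading coordinate is the apex.
\<close>

lemma block_matrix_LOP_iff:
  "block_matrix a b e A \<in> LOP \<longleftrightarrow> (\<forall>u. norm u \<le> 1 \<longrightarrow> norm (e + A *v u) \<le> a + b \<bullet> u)"
  (is "_ \<longleftrightarrow> ?R")
proof
  assume L: "block_matrix a b e A \<in> LOP"
  show ?R
  proof (intro allI impI)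
    fix u :: "real ^ 'a" assume "norm u \<le> 1"
    then have "block_matrix a b e A *v vcat 1 u \<in> lorentz_cone"
      using L by (simp add: LOP_def vcat_mem_lorentz_cone)
    then show "norm (e + A *v u) \<le> a + b \<bullet> u"
      by (simp add: block_matrix_mult vcat_mem_lorentz_cone)
  qed
next
  assume R: ?R
  have "block_matrix a b e A *v y \<in> lorentz_cone" if "y \<in> lorentz_cone" for y
  proof -
    obtain s x where y: "y = vcat s x" by (rule vcat_cases)
    have x: "norm x \<le> s" using that by (simp add: y vcat_mem_lorentz_cone)
    have "norm (s *\<^sub>R e + A *v x) \<le> a * s + b \<bullet> x"
    proof (cases "s = 0")
      case True
      with x show ?thesis by simp
    next
      case False
      then have s: "s > 0" using x norm_ge_zero[of x] by linarith
      have "norm (x /\<^sub>R s) \<le> 1" using s x by (simp add: field_simps)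
      then have "norm (e + A *v (x /\<^sub>R s)) \<le> a + b \<bullet> (x /\<^sub>R s)"
        using R by blast
      then have "s * norm (e + A *v (x /\<^sub>R s)) \<le> s * (a + b \<bullet> (x /\<^sub>R s))"
        using s by simp
      moreover have "s * norm (e + A *v (x /\<^sub>R s)) = norm (s *\<^sub>R (e + A *v (x /\<^sub>R s)))"
        using s by simp
      moreover have "s *\<^sub>R (e + A *v (x /\<^sub>R s)) = s *\<^sub>R e + A *v x"
        using s by (simp add: algebra_simps matrix_vector_mult_scaleR)
      moreover have "s * (a + b \<bullet> (x /\<^sub>R s)) = a * s + b \<bullet> x"
        using s by (simp add: algebra_simps)
      ultimately show ?thesis by simp
    qed
    then show ?thesis by (simp add: y block_matrix_mult vcat_mem_lorentz_cone)
  qed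
  then show "block_matrix a b e A \<in> LOP" by (simp add: LOP_def)
qed

text \<open>With the convention \<open>0 /\<^sub>R 0 = 0\<close> these hold for \<open>v = 0\<close> as well.\<close>

lemma neg_normalized:
  fixes v :: "'a::real_inner"
  shows "norm (- (v /\<^sub>R norm v)) \<le> 1" and "- (v /\<^sub>R norm v) \<bullet> v = - norm v"
  by (auto simp: dot_square_norm power2_eq_square field_simps)

lemma norm_le_iff_unit_ball_inner:
  fixes v :: "'a::real_inner"
  shows "norm v \<le> t \<longleftrightarrow> (\<forall>w. norm w \<le> 1 \<longrightarrow> - t \<le> w \<bullet> v)"
proof
  assume v: "norm v \<le> t"
  show "\<forall>w. norm w \<le> 1 \<longrightarrow> - t \<le> w \<bullet> v"
  proof (intro allI impI)
    fix w :: 'a assume "norm w \<le> 1"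
    then have "\<bar>w \<bullet> v\<bar> \<le> norm v"
      using Cauchy_Schwarz_ineq2[of w v] mult_right_mono[of "norm w" 1 "norm v"] by simp
    with v show "- t \<le> w \<bullet> v" by linarith
  qed
next
  assume "\<forall>w. norm w \<le> 1 \<longrightarrow> - t \<le> w \<bullet> v"
  then show "norm v \<le> t"
    using neg_normalized[of v] by fastforce
qed

section \<open>Lower bounds of a bilinear objective on two unit balls\<close>

lemma bilinear_obj_regroup: "bilinear_obj c d R u w = c \<bullet> u + w \<bullet> (d + R *v u)"
  by (simp add: bilinear_obj_def inner_add_right inner_commute)

text \<open>
  Dualizing the norm in \<open>block_matrix_LOP_iff\<close> introduces the second variable \<open>w\<close> of the
  bilinear problem.
\<close>

lemma block_matrix_LOP_iff_lower_bound:
  "block_matrix (- \<alpha>) c d R \<in> LOP \<longleftrightarrow>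
     (\<forall>u w. norm u \<le> 1 \<and> norm w \<le> 1 \<longrightarrow> \<alpha> \<le> bilinear_obj c d R u w)"
proof -
  have "norm (d + R *v u) \<le> - \<alpha> + c \<bullet> u \<longleftrightarrow>
      (\<forall>w. norm w \<le> 1 \<longrightarrow> \<alpha> \<le> bilinear_obj c d R u w)" for u
  proof -
    have "- (- \<alpha> + c \<bullet> u) \<le> w \<bullet> (d + R *v u) \<longleftrightarrow> \<alpha> \<le> bilinear_obj c d R u w" for w
      by (simp only: bilinear_obj_regroup) linarith
    then show ?thesis
      using norm_le_iff_unit_ball_inner[of "d + R *v u" "- \<alpha> + c \<bullet> u"] by simp
  qed
  then show ?thesis by (auto simp: block_matrix_LOP_iff)
qed

lemma bilinear_obj_affine_substitution:
  "bilinear_obj c d R (xc + F *v u) (yc + G *v w) =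
     c \<bullet> xc + d \<bullet> yc + yc \<bullet> (R *v xc) +
     bilinear_obj (transpose F *v (c + transpose R *v yc)) (transpose G *v (d + R *v xc))
       (transpose G ** R ** F) u w"
proof -
  have adj: "w \<bullet> (v v* G) = (G *v w) \<bullet> v" for v
    by (metis dot_lmul_matrix inner_commute)
  show ?thesis
    by (simp add: bilinear_obj_def adj dot_lmul_matrix matrix_vector_right_distrib
        vector_matrix_left_distrib inner_add_left inner_add_right inner_commute[of _ "R *v xc"]
        flip: matrix_vector_mul_assoc)
qed

lemma bilinear_obj_unit_balls_min_exists:
  fixes c :: "real ^ 'm::finite" and d :: "real ^ 'n::finite"
  shows "\<exists>u0 w0. norm u0 \<le> 1 \<and> norm w0 \<le> 1 \<and>
    (\<forall>u w. norm u \<le> 1 \<and> norm w \<le> 1 \<longrightarrow> bilinear_obj c d R u0 w0 \<le> bilinear_obj c d R u w)"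
proof -
  let ?B = "cball (0::real^'m) 1 \<times> cball (0::real^'n) 1"
  have "continuous_on ?B (\<lambda>p. bilinear_obj c d R (fst p) (snd p))"
    unfolding bilinear_obj_def
    by (intro continuous_intros continuous_on_compose2[OF matrix_vector_mult_linear_continuous_on])
       auto
  moreover have "compact ?B" "?B \<noteq> {}"
    by (auto intro: compact_Times)
  ultimately obtain p where "p \<in> ?B"
    "\<forall>p'\<in>?B. bilinear_obj c d R (fst p) (snd p) \<le> bilinear_obj c d R (fst p') (snd p')"
    using continuous_attains_inf[of ?B "\<lambda>p. bilinear_obj c d R (fst p) (snd p)"] by auto
  then show ?thesis by (intro exI[of _ "fst p"] exI[of _ "snd p"]) auto
qed

lemma bilinear_obj_ge_on_unit_balls:
  assumes "norm u \<le> 1" "norm w \<le> 1"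
  shows "- norm c - norm d - spectral_norm R \<le> bilinear_obj c d R u w"
proof -
  have "- norm c \<le> u \<bullet> c" "- norm d \<le> w \<bullet> d" "- norm (R *v u) \<le> w \<bullet> (R *v u)"
    using assms norm_le_iff_unit_ball_inner by blast+
  moreover have "norm (R *v u) \<le> spectral_norm R"
  proof -
    have bl: "bounded_linear ((*v) R)" by (rule matrix_vector_mul_bounded_linear)
    have "norm (R *v u) \<le> onorm ((*v) R) * norm u" by (rule onorm[OF bl])
    also have "\<dots> \<le> onorm ((*v) R)"
      using mult_left_mono[OF assms(1) onorm_pos_le[OF bl]] by simp
    finally show ?thesis by (simp add: spectral_norm_def)
  qed
  ultimately show ?thesis by (simp add: bilinear_obj_def inner_commute)
qed

text \<open>A lower bound holds in particular at the minimizer of each linear part, the other variable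
  being zero.\<close>

lemma lower_bound_le_linear_parts:
  assumes "\<And>u w. norm u \<le> 1 \<Longrightarrow> norm w \<le> 1 \<Longrightarrow> \<alpha> \<le> bilinear_obj c d R u w"
  shows "\<alpha> \<le> - max (norm c) (norm d)"
proof -
  have "\<alpha> \<le> - norm c"
    using assms[of "- (c /\<^sub>R norm c)" 0] neg_normalized[of c]
    by (simp add: bilinear_obj_def inner_commute)
  moreover have "\<alpha> \<le> - norm d"
    using assms[of 0 "- (d /\<^sub>R norm d)"] neg_normalized[of d]
    by (simp add: bilinear_obj_def inner_commute)
  ultimately show ?thesis by simp
qed

section \<open>The trust-region test\<close>

text \<open>
  The bound on \<open>a\<close> makes \<open>a + b \<bullet> u\<close> nonnegative throughout the unit ball, so comparing it with
  a norm is the same as comparing the squares.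
\<close>

lemma block_matrix_LOP_iff_trust_region:
  fixes e :: "real ^ 'n::finite"
  assumes "norm b \<le> a"
  obtains v where
    "is_min_value (\<lambda>u. (a + b \<bullet> u)\<^sup>2 - (norm (e + A *v u))\<^sup>2) {u. norm u \<le> 1} v"
    "block_matrix a b e A \<in> LOP \<longleftrightarrow> 0 \<le> v"
proof -
  let ?g = "\<lambda>u. (a + b \<bullet> u)\<^sup>2 - (norm (e + A *v u))\<^sup>2"
  have "continuous_on (cball 0 1) ?g"
    by (intro continuous_intros matrix_vector_mult_linear_continuous_on)
  then obtain u0 where u0: "u0 \<in> cball 0 1" "\<forall>u\<in>cball 0 1. ?g u0 \<le> ?g u"
    using continuous_attains_inf[of "cball 0 1" ?g] by auto
  then have min: "is_min_value ?g {u. norm u \<le> 1} (?g u0)"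
    by (auto simp: is_min_value_def)
  have "norm (e + A *v u) \<le> a + b \<bullet> u \<longleftrightarrow> 0 \<le> ?g u" if "norm u \<le> 1" for u
  proof -
    have "0 \<le> a + b \<bullet> u"
      using assms that norm_le_iff_unit_ball_inner[of b a] by (fastforce simp: inner_commute)
    then show ?thesis using abs_le_square_iff[of "norm (e + A *v u)" "a + b \<bullet> u"] by simp
  qed
  then have "block_matrix a b e A \<in> LOP \<longleftrightarrow> (\<forall>u. norm u \<le> 1 \<longrightarrow> 0 \<le> ?g u)"
    by (auto simp: block_matrix_LOP_iff)
  also have "\<dots> \<longleftrightarrow> 0 \<le> ?g u0"
    using u0 by (force simp: dist_norm)
  finally show ?thesis using min that by blast
qed

section \<open>Correctness of the bisection\<close>

theorem mainTheorem4:
  fixes c xc c' :: "real ^ 'm::finite"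
    and d yc d' :: "real ^ 'n::finite"
    and R R' :: "real ^ 'm ^ 'n"
    and F :: "real ^ 'm ^ 'm"
    and G :: "real ^ 'n ^ 'n"
    and \<gamma> :: real
    and f :: "real ^ 'm \<Rightarrow> real ^ 'n \<Rightarrow> real"
    and M :: "real \<Rightarrow> real ^ ('m option) ^ ('n option)"
    and M0 :: "real \<Rightarrow> real ^ ('m option)"
    and Mbar :: "real \<Rightarrow> real ^ ('m option) ^ 'n"
  assumes dims: "min (CARD('n)) (CARD('m)) \<ge> 2"
    and F: "invertible F" and G: "invertible G"
    and f: "f = bilinear_obj c d R"
    and gamma: "\<gamma> = c \<bullet> xc + d \<bullet> yc + yc \<bullet> (R *v xc)"
    and c': "c' = transpose F *v (c + transpose R *v yc)"
    and d': "d' = transpose G *v (d + R *v xc)"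
    and R': "R' = transpose G ** R ** F"
    and M: "\<And>\<alpha>. M \<alpha> = block_matrix (- \<alpha>) c' d' R'"
    and M0: "\<And>\<alpha>. M0 \<alpha> = top_row (M \<alpha>)"
    and Mbar: "\<And>\<alpha>. Mbar \<alpha> = lower_rows (M \<alpha>)"
  shows "\<exists>zstar.
      is_min_value (\<lambda>(x, y). f x y) (ellipsoid xc F \<times> ellipsoid yc G) zstar \<and>
      \<comment> \<open>(i)\<close>
      (\<exists>\<alpha>. M \<alpha> \<in> LOP \<and> (\<forall>\<beta>. M \<beta> \<in> LOP \<longrightarrow> \<beta> \<le> \<alpha>) \<and>
           \<alpha> \<in> {- norm c' - norm d' - spectral_norm R' .. - max (norm c') (norm d')}) \<and>
      (\<forall>\<alpha> \<le> - norm c' - norm d' - spectral_norm R'. M \<alpha> \<in> LOP) \<and>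
      \<comment> \<open>(ii)\<close>
      (\<forall>\<alpha> \<le> - max (norm c') (norm d').
         \<exists>v. is_min_value (\<lambda>u. (M0 \<alpha> \<bullet> vcat 1 u)\<^sup>2 - (norm (Mbar \<alpha> *v vcat 1 u))\<^sup>2)
               {u. norm u \<le> 1} v \<and>
             (M \<alpha> \<in> LOP \<longleftrightarrow> 0 \<le> v)) \<and>
      \<comment> \<open>(iii)\<close>
      (\<forall>\<epsilon> \<alpha>min \<alpha>max.
         \<epsilon> > 0 \<and> \<alpha>min \<le> \<alpha>max \<and> \<alpha>max \<le> - max (norm c') (norm d') \<and>
         M \<alpha>min \<in> LOP \<and> \<alpha>max - \<alpha>min \<le> \<epsilon> \<longrightarrow>
         \<gamma> + \<alpha>min \<le> zstar \<and>
         (\<forall>\<alpha> \<in> {\<alpha>min..\<alpha>max}. M \<alpha> \<notin> LOP \<longrightarrow>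
            (\<exists>u. norm u \<le> 1 \<and> M0 \<alpha> \<bullet> vcat 1 u < norm (Mbar \<alpha> *v vcat 1 u)) \<and>
            (\<forall>u vbar w x y.
               norm u \<le> 1 \<and> M0 \<alpha> \<bullet> vcat 1 u < norm (Mbar \<alpha> *v vcat 1 u) \<and>
               vbar = Mbar \<alpha> *v vcat 1 u \<and> w = - (vbar /\<^sub>R norm vbar) \<and>
               x = xc + F *v u \<and> y = yc + G *v w \<longrightarrow>
               x \<in> ellipsoid xc F \<and> y \<in> ellipsoid yc G \<and>
               f x y < \<gamma> + \<alpha>min + \<epsilon> \<and> \<gamma> + \<alpha>min + \<epsilon> \<le> zstar + \<epsilon>)))"
proof -
  define q where "q = bilinear_obj c' d' R'"
  have f_eq: "f (xc + F *v u) (yc + G *v w) = \<gamma> + q u w" for u w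
    by (simp add: f gamma q_def c' d' R' bilinear_obj_affine_substitution)
  have q_eq: "q u w = c' \<bullet> u + w \<bullet> (d' + R' *v u)" for u w
    by (simp add: q_def bilinear_obj_regroup)
  have LOP_iff: "M \<alpha> \<in> LOP \<longleftrightarrow> (\<forall>u w. norm u \<le> 1 \<and> norm w \<le> 1 \<longrightarrow> \<alpha> \<le> q u w)" for \<alpha>
    by (simp add: M q_def block_matrix_LOP_iff_lower_bound)
  have top: "M0 \<alpha> \<bullet> vcat 1 u = - \<alpha> + c' \<bullet> u" for \<alpha> u
    by (simp add: M0 M top_row_block_matrix inner_vcat)
  have low: "Mbar \<alpha> *v vcat 1 u = d' + R' *v u" for \<alpha> u
    by (simp add: Mbar M lower_rows_block_matrix_mult)
  obtain u0 w0 where u0: "norm u0 \<le> 1" and w0: "norm w0 \<le> 1"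
    and q_min: "\<forall>u w. norm u \<le> 1 \<and> norm w \<le> 1 \<longrightarrow> q u0 w0 \<le> q u w"
    using bilinear_obj_unit_balls_min_exists[of c' d' R'] unfolding q_def by blast
  have LOP_iff_min: "M \<alpha> \<in> LOP \<longleftrightarrow> \<alpha> \<le> q u0 w0" for \<alpha>
  proof
    assume "M \<alpha> \<in> LOP"
    then show "\<alpha> \<le> q u0 w0" using u0 w0 by (simp add: LOP_iff)
  next
    assume "\<alpha> \<le> q u0 w0"
    then show "M \<alpha> \<in> LOP" unfolding LOP_iff using q_min by fastforce
  qed
  have lower: "- norm c' - norm d' - spectral_norm R' \<le> q u0 w0"
    unfolding q_def using u0 w0 by (rule bilinear_obj_ge_on_unit_balls)
  have upper: "q u0 w0 \<le> - max (norm c') (norm d')"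
    using q_min lower_bound_le_linear_parts[of "q u0 w0" c' d' R'] by (simp add: q_def)

  have zstar: "is_min_value (\<lambda>(x, y). f x y) (ellipsoid xc F \<times> ellipsoid yc G) (\<gamma> + q u0 w0)"
    unfolding is_min_value_def
  proof
    have "(xc + F *v u0, yc + G *v w0) \<in> ellipsoid xc F \<times> ellipsoid yc G"
      using u0 w0 by (auto simp: ellipsoid_def)
    then show "\<exists>s\<in>ellipsoid xc F \<times> ellipsoid yc G. (case s of (x, y) \<Rightarrow> f x y) = \<gamma> + q u0 w0"
      by (rule rev_bexI) (simp add: f_eq)
    show "\<forall>s\<in>ellipsoid xc F \<times> ellipsoid yc G. \<gamma> + q u0 w0 \<le> (case s of (x, y) \<Rightarrow> f x y)"
      using q_min by (auto simp: ellipsoid_def f_eq)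
  qed
  have i: "\<exists>\<alpha>. M \<alpha> \<in> LOP \<and> (\<forall>\<beta>. M \<beta> \<in> LOP \<longrightarrow> \<beta> \<le> \<alpha>) \<and>
      \<alpha> \<in> {- norm c' - norm d' - spectral_norm R' .. - max (norm c') (norm d')}"
    by (rule exI[of _ "q u0 w0"]) (use lower upper in \<open>simp only: LOP_iff_min atLeastAtMost_iff, simp\<close>)
  have i': "\<forall>\<alpha> \<le> - norm c' - norm d' - spectral_norm R'. M \<alpha> \<in> LOP"
    using lower LOP_iff_min by auto
  have ii: "\<forall>\<alpha> \<le> - max (norm c') (norm d').
      \<exists>v. is_min_value (\<lambda>u. (M0 \<alpha> \<bullet> vcat 1 u)\<^sup>2 - (norm (Mbar \<alpha> *v vcat 1 u))\<^sup>2)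
            {u. norm u \<le> 1} v \<and> (M \<alpha> \<in> LOP \<longleftrightarrow> 0 \<le> v)"
  proof (intro allI impI)
    fix \<alpha> assume "\<alpha> \<le> - max (norm c') (norm d')"
    then have "norm c' \<le> - \<alpha>" by simp
    then show "\<exists>v. is_min_value (\<lambda>u. (M0 \<alpha> \<bullet> vcat 1 u)\<^sup>2 - (norm (Mbar \<alpha> *v vcat 1 u))\<^sup>2)
            {u. norm u \<le> 1} v \<and> (M \<alpha> \<in> LOP \<longleftrightarrow> 0 \<le> v)"
      unfolding top low M by (rule block_matrix_LOP_iff_trust_region) blast
  qed
  have violated: "\<exists>u. norm u \<le> 1 \<and> M0 \<alpha> \<bullet> vcat 1 u < norm (Mbar \<alpha> *v vcat 1 u)"
    if "M \<alpha> \<notin> LOP" for \<alpha>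
    using that unfolding top low by (auto simp: M block_matrix_LOP_iff not_le)
  have recover: "xc + F *v u \<in> ellipsoid xc F \<and> yc + G *v w \<in> ellipsoid yc G \<and>
      f (xc + F *v u) (yc + G *v w) < \<gamma> + \<alpha>"
    if "norm u \<le> 1" "M0 \<alpha> \<bullet> vcat 1 u < norm (Mbar \<alpha> *v vcat 1 u)"
      "vbar = Mbar \<alpha> *v vcat 1 u" "w = - (vbar /\<^sub>R norm vbar)" for \<alpha> u vbar w
  proof -
    have vbar: "vbar = d' + R' *v u" using that(3) by (simp only: low)
    \<comment> \<open>Hence \<open>q u w = c' \<bullet> u - norm vbar\<close>, which the violated inequality puts below \<open>\<alpha>\<close>.\<close>
    have "norm w \<le> 1" and "w \<bullet> vbar = - norm vbar"
      unfolding that(4) by (rule neg_normalized)+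
    moreover have "- \<alpha> + c' \<bullet> u < norm vbar"
      using that(2) by (simp only: top low vbar)
    ultimately show ?thesis
      using that(1) by (auto simp: ellipsoid_def f_eq q_eq vbar)
  qed
  have iii: "(\<forall>\<epsilon> \<alpha>min \<alpha>max.
         \<epsilon> > 0 \<and> \<alpha>min \<le> \<alpha>max \<and> \<alpha>max \<le> - max (norm c') (norm d') \<and>
         M \<alpha>min \<in> LOP \<and> \<alpha>max - \<alpha>min \<le> \<epsilon> \<longrightarrow>
         \<gamma> + \<alpha>min \<le> (\<gamma> + q u0 w0) \<and>
         (\<forall>\<alpha> \<in> {\<alpha>min..\<alpha>max}. M \<alpha> \<notin> LOP \<longrightarrow>
            (\<exists>u. norm u \<le> 1 \<and> M0 \<alpha> \<bullet> vcat 1 u < norm (Mbar \<alpha> *v vcat 1 u)) \<and>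
            (\<forall>u vbar w x y.
               norm u \<le> 1 \<and> M0 \<alpha> \<bullet> vcat 1 u < norm (Mbar \<alpha> *v vcat 1 u) \<and>
               vbar = Mbar \<alpha> *v vcat 1 u \<and> w = - (vbar /\<^sub>R norm vbar) \<and>
               x = xc + F *v u \<and> y = yc + G *v w \<longrightarrow>
               x \<in> ellipsoid xc F \<and> y \<in> ellipsoid yc G \<and>
               f x y < \<gamma> + \<alpha>min + \<epsilon> \<and> \<gamma> + \<alpha>min + \<epsilon> \<le> (\<gamma> + q u0 w0) + \<epsilon>)))"
    (is "\<forall>\<epsilon> \<alpha>min \<alpha>max. ?H \<epsilon> \<alpha>min \<alpha>max \<longrightarrow> ?C \<epsilon> \<alpha>min \<alpha>max")
  proof (intro allI impI)
    fix \<epsilon> \<alpha>min \<alpha>max :: real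
    assume H: "?H \<epsilon> \<alpha>min \<alpha>max"
    then have min: "\<alpha>min \<le> q u0 w0" by (simp add: LOP_iff_min)
    show "?C \<epsilon> \<alpha>min \<alpha>max"
    proof (rule conjI, use min in simp, intro ballI allI impI conjI)
      fix \<alpha> assume \<alpha>: "\<alpha> \<in> {\<alpha>min..\<alpha>max}" and "M \<alpha> \<notin> LOP"
      then show "\<exists>u. norm u \<le> 1 \<and> M0 \<alpha> \<bullet> vcat 1 u < norm (Mbar \<alpha> *v vcat 1 u)"
        by (intro violated)
      have "\<alpha> \<le> \<alpha>min + \<epsilon>" using H \<alpha> by auto
      moreover have "\<gamma> + \<alpha>min + \<epsilon> \<le> (\<gamma> + q u0 w0) + \<epsilon>" using min by simp
      ultimately show "x \<in> ellipsoid xc F" "y \<in> ellipsoid yc G"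
          "f x y < \<gamma> + \<alpha>min + \<epsilon>" "\<gamma> + \<alpha>min + \<epsilon> \<le> (\<gamma> + q u0 w0) + \<epsilon>"
        if "norm u \<le> 1 \<and> M0 \<alpha> \<bullet> vcat 1 u < norm (Mbar \<alpha> *v vcat 1 u) \<and>
          vbar = Mbar \<alpha> *v vcat 1 u \<and> w = - (vbar /\<^sub>R norm vbar) \<and>
          x = xc + F *v u \<and> y = yc + G *v w" for u vbar w x y
        using recover[of u \<alpha> vbar w] that by simp_all
    qed
  qed
  show ?thesis
    by (rule exI[of _ "\<gamma> + q u0 w0"]) (rule conjI[OF zstar conjI[OF i conjI[OF i' conjI[OF ii iii]]]])
qed

end
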